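(* For all $z,w,u,v,u'\in\mathbb{C}$ the following hold. For all integers $n,n'\ge 0$, $$\sum_{m=0}^{+\infty}\sum_{m'=0}^{+\infty}\frac{u^m}{m!}\frac{u'^{m'}}{m'!}H_{m,n,m',n'}(z,w)=(\overline{z}-i\overline{w}-u)^n(z-iw-u')^{n'}e^{u(z+iw)+u'(\overline{z}+i\overline{w})},$$ and for all integers $m',n'\ge 0$, $$\sum_{m=0}^{+\infty}\sum_{n=0}^{+\infty}\frac{u^m}{m!}\frac{v^n}{n!}H_{m,n,m',n'}(z,w)=e^{-uv+u(z+iw)+v(\overline{z}-i\overline{w})}H_{m',n'}(\overline{z}+i\overline{w},z-iw).$$
   Context: For integers $m,n\ge 0$ and $\zeta\in\mathbb{C}$, $H_{m,n}(\zeta,\overline{\zeta})=(-1)^{m+n}e^{|\zeta|^2}\frac{\partial^{m+n}}{\partial\overline{\zeta}^{m}\partial\zeta^{n}}\left(e^{-|\zeta|^2}\right)$ (Wirtinger derivatives), and for $(z,w)\in\mathbb{C}^2$, $H_{m,n,m',n'}(z,w)=H_{m,n}(z+iw,\overline{z}-i\overline{w})\,H_{m',n'}(\overline{z}+i\overline{w},z-iw)$. *)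

theory Defs
  imports "HOL-Analysis.Analysis"
begin

text \<open>Wirtinger derivatives, for functions that need only be differentiable in the real sense:
  with \<open>\<zeta> = x + \<i>y\<close> they are \<open>(\<partial>/\<partial>x - \<i> \<partial>/\<partial>y)/2\<close> and \<open>(\<partial>/\<partial>x + \<i> \<partial>/\<partial>y)/2\<close>.\<close>

definition partial_x :: "(complex \<Rightarrow> complex) \<Rightarrow> complex \<Rightarrow> complex" where
  "partial_x f \<zeta> = vector_derivative (\<lambda>t::real. f (\<zeta> + of_real t)) (at 0)"

definition partial_y :: "(complex \<Rightarrow> complex) \<Rightarrow> complex \<Rightarrow> complex" where
  "partial_y f \<zeta> = vector_derivative (\<lambda>t::real. f (\<zeta> + \<i> * of_real t)) (at 0)"

definition wirtinger :: "(complex \<Rightarrow> complex) \<Rightarrow> complex \<Rightarrow> complex" where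
  "wirtinger f \<zeta> = (partial_x f \<zeta> - \<i> * partial_y f \<zeta>) / 2"

definition wirtinger_cnj :: "(complex \<Rightarrow> complex) \<Rightarrow> complex \<Rightarrow> complex" where
  "wirtinger_cnj f \<zeta> = (partial_x f \<zeta> + \<i> * partial_y f \<zeta>) / 2"

text \<open>\<open>complex_hermite m n \<zeta>\<close> is the value written \<open>H\<^sub>m\<^sub>,\<^sub>n(\<zeta>, cnj \<zeta>)\<close> in the literature; the second
  argument is always the conjugate of the first, so it is not passed separately.\<close>

definition complex_hermite :: "nat \<Rightarrow> nat \<Rightarrow> complex \<Rightarrow> complex" where
  "complex_hermite m n \<zeta> = (-1) ^ (m + n) * of_real (exp ((cmod \<zeta>)\<^sup>2)) *
     (wirtinger_cnj ^^ m) ((wirtinger ^^ n) (\<lambda>\<xi>. of_real (exp (- (cmod \<xi>)\<^sup>2)))) \<zeta>"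

text \<open>The product \<open>H\<^sub>m\<^sub>,\<^sub>n(z + \<i>w, cnj z - \<i> cnj w) H\<^sub>m\<^sub>'\<^sub>,\<^sub>n\<^sub>'(cnj z + \<i> cnj w, z - \<i>w)\<close>. In both factors the
  second argument is the conjugate of the first:\<close>

lemma cnj_hermite_arguments:
  "cnj (z + \<i> * w) = cnj z - \<i> * cnj w"
  "cnj (cnj z + \<i> * cnj w) = z - \<i> * w"
  by simp_all

definition complex_hermite2 :: "nat \<Rightarrow> nat \<Rightarrow> nat \<Rightarrow> nat \<Rightarrow> complex \<Rightarrow> complex \<Rightarrow> complex" where
  "complex_hermite2 m n m' n' z w =
     complex_hermite m n (z + \<i> * w) * complex_hermite m' n' (cnj z + \<i> * cnj w)"

end

(* On the Gaussian exp (- a b), with a and b standing for the variable and its conjugate, the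
   Wirtinger derivatives act as the partial derivatives in a and b, so that
     H_{m,n} = sum_k (-1)^k k! (m choose k) (n choose k) a^(m-k) b^(n-k).
   Putting m = k + i and n = k + j turns both generating series into products of absolutely
   convergent ones: a binomial sum times an exponential series for fixed n, and three exponential
   series with exponents - u v, u a and v b for the double series. *)

theory Submission
  imports Defs
begin

section \<open>An explicit formula for the complex Hermite polynomials\<close>

text \<open>A real-linear map \<open>A * h + B * cnj h\<close> takes the values \<open>A + B\<close>
  at 1 and \<open>\<i> * (A - B)\<close> at \<open>\<i>\<close>, which determine \<open>A\<close>
  and \<open>B\<close>. So a derivative in this form displays both Wirtinger derivatives as
  coefficients.\<close>

lemma wirtinger_eqs:
  assumes "(f has_derivative (\<lambda>h. A * h + B * cnj h)) (at \<zeta>)"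
  shows "wirtinger f \<zeta> = A" "wirtinger_cnj f \<zeta> = B"
proof -
  have *: "vector_derivative (\<lambda>t::real. f (\<zeta> + c * of_real t)) (at 0) = A * c + B * cnj c" for c
  proof (rule vector_derivative_at)
    have "((\<lambda>t::real. \<zeta> + c * of_real t) has_derivative (\<lambda>t. c * of_real t)) (at 0)"
      by (auto intro!: derivative_eq_intros)
    from has_derivative_compose[OF this, of f "\<lambda>h. A * h + B * cnj h"] assms
    show "((\<lambda>t::real. f (\<zeta> + c * of_real t)) has_vector_derivative A * c + B * cnj c) (at 0)"
      by (simp add: has_vector_derivative_def scaleR_conv_of_real algebra_simps)
  qed
  have "partial_x f \<zeta> = A + B" "partial_y f \<zeta> = \<i> * (A - B)"
    using *[of 1] *[of \<i>] by (simp_all add: partial_x_def partial_y_def algebra_simps)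
  then show "wirtinger f \<zeta> = A" "wirtinger_cnj f \<zeta> = B"
    by (simp_all add: wirtinger_def wirtinger_cnj_def flip: mult.assoc)
qed

text \<open>The exponent is a complex product instead of a squared norm, so that the product rule
  applies to it directly.\<close>

definition gaussian :: "complex \<Rightarrow> complex" where
  "gaussian \<zeta> = exp (- (\<zeta> * cnj \<zeta>))"

lemma has_derivative_cnj: "(cnj has_derivative cnj) F"
  by (rule bounded_linear_imp_has_derivative) (rule bounded_linear_cnj)

text \<open>Differentiation reproduces the Gaussian with a factor \<open>- cnj \<zeta>\<close> or
  \<open>- \<zeta>\<close>, so the product rule yields operators on \<open>p\<close> alone.\<close>

lemma wirtinger_mult_gaussian:
  assumes "(p has_derivative (\<lambda>h. A * h + B * cnj h)) (at \<zeta>)"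
  shows "wirtinger (\<lambda>\<xi>. p \<xi> * gaussian \<xi>) \<zeta> = (A - cnj \<zeta> * p \<zeta>) * gaussian \<zeta>"
    and "wirtinger_cnj (\<lambda>\<xi>. p \<xi> * gaussian \<xi>) \<zeta> = (B - \<zeta> * p \<zeta>) * gaussian \<zeta>"
proof -
  have e: "(exp has_derivative (\<lambda>h. h * exp x)) (at x)" for x :: complex
    by (rule has_derivative_eq_rhs[OF DERIV_exp[unfolded has_field_derivative_def]])
      (simp add: fun_eq_iff mult.commute)
  have "((\<lambda>\<xi>. - (\<xi> * cnj \<xi>)) has_derivative (\<lambda>h. - (\<zeta> * cnj h + h * cnj \<zeta>))) (at \<zeta>)"
    by (intro has_derivative_minus has_derivative_mult has_derivative_ident has_derivative_cnj)
  from has_derivative_compose[OF this e]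
  have "(gaussian has_derivative (\<lambda>h. - (\<zeta> * cnj h + h * cnj \<zeta>) * gaussian \<zeta>)) (at \<zeta>)"
    by (simp add: gaussian_def [abs_def])
  from has_derivative_mult[OF assms this]
  have "((\<lambda>\<xi>. p \<xi> * gaussian \<xi>) has_derivative
      (\<lambda>h. ((A - cnj \<zeta> * p \<zeta>) * gaussian \<zeta>) * h + ((B - \<zeta> * p \<zeta>) * gaussian \<zeta>) * cnj h)) (at \<zeta>)"
    by (rule has_derivative_eq_rhs) (auto simp: algebra_simps)
  from wirtinger_eqs[OF this]
  show "wirtinger (\<lambda>\<xi>. p \<xi> * gaussian \<xi>) \<zeta> = (A - cnj \<zeta> * p \<zeta>) * gaussian \<zeta>"
    and "wirtinger_cnj (\<lambda>\<xi>. p \<xi> * gaussian \<xi>) \<zeta> = (B - \<zeta> * p \<zeta>) * gaussian \<zeta>" .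
qed

section \<open>The Hermite polynomials in two independent variables\<close>

text \<open>Truncation in \<open>n - k\<close> is harmless, since \<open>n choose k\<close> vanishes
  for k > n. The factor \<open>m choose k\<close> stands apart so that Pascal's rule can act on
  it.\<close>

definition hermite_poly :: "nat \<Rightarrow> nat \<Rightarrow> complex \<Rightarrow> complex \<Rightarrow> complex" where
  "hermite_poly m n a b =
     (\<Sum>k\<le>m. of_nat (m choose k) * ((-1) ^ k * fact k * of_nat (n choose k) * a ^ (m - k) * b ^ (n - k)))"

lemma hermite_poly_0 [simp]: "hermite_poly 0 n a b = b ^ n"
  by (simp add: hermite_poly_def)

lemma sum_choose_Suc:
  fixes f :: "nat \<Rightarrow> 'a::comm_semiring_1"
  shows "(\<Sum>k\<le>Suc m. of_nat (Suc m choose k) * f k)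
       = (\<Sum>k\<le>m. of_nat (m choose k) * f k) + (\<Sum>k\<le>m. of_nat (m choose k) * f (Suc k))"
proof -
  have "(\<Sum>k\<le>m. of_nat (m choose k) * f k) = (\<Sum>k\<le>Suc m. of_nat (m choose k) * f k)"
    by (simp add: binomial_eq_0)
  also have "\<dots> = f 0 + (\<Sum>k\<le>m. of_nat (m choose Suc k) * f (Suc k))"
    by (subst sum.atMost_Suc_shift) simp
  finally show ?thesis
    by (subst sum.atMost_Suc_shift) (simp add: sum.distrib algebra_simps)
qed

lemma of_nat_choose_absorption:
  "of_nat n * of_nat ((n - 1) choose k) = (of_nat (Suc k) * of_nat (n choose Suc k) :: 'a::semiring_1)"
  by (metis binomial_absorption of_nat_mult)

lemma of_nat_choose_absorb_comp:
  "of_nat (n choose k) * of_nat (n - k) = (of_nat n * of_nat ((n - 1) choose k) :: 'a::comm_semiring_1)"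
  by (metis binomial_absorb_comp of_nat_mult mult.commute)

text \<open>This is multiplication by \<open>a\<close> minus differentiation in \<open>b\<close>,
  which lowers \<open>n\<close> by one. For n = 0 the coefficient \<open>of_nat n\<close> removes
  the term with the truncated index.\<close>

lemma hermite_poly_Suc:
  "hermite_poly (Suc m) n a b = a * hermite_poly m n a b - of_nat n * hermite_poly m (n - 1) a b"
proof -
  \<comment> \<open>With exponent \<open>Suc m - k\<close>, the unshifted half of Pascal's rule
    keeps a spare factor \<open>a\<close>; in the shifted half the exponent is \<open>m - k\<close>,
    and absorption extracts \<open>n\<close>.\<close>
  define f where "f k = (-1) ^ k * fact k * of_nat (n choose k) * a ^ (Suc m - k) * b ^ (n - k)" for k
  have "(\<Sum>k\<le>m. of_nat (m choose k) * f k) = a * hermite_poly m n a b"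
    unfolding hermite_poly_def sum_distrib_left
    by (rule sum.cong) (auto simp: f_def Suc_diff_le)
  moreover have "(\<Sum>k\<le>m. of_nat (m choose k) * f (Suc k)) = - (of_nat n * hermite_poly m (n - 1) a b)"
    unfolding hermite_poly_def sum_distrib_left sum_negf[symmetric]
  proof (rule sum.cong)
    fix k
    have "f (Suc k) = - ((-1) ^ k * fact k * (of_nat (Suc k) * of_nat (n choose Suc k)) * a ^ (m - k) * b ^ (n - 1 - k))"
      by (simp add: f_def algebra_simps)
    also have "\<dots> = - (of_nat n * ((-1) ^ k * fact k * of_nat ((n - 1) choose k) * a ^ (m - k) * b ^ (n - 1 - k)))"
      unfolding of_nat_choose_absorption[symmetric] by (simp only: ac_simps)
    finally show "of_nat (m choose k) * f (Suc k) = - (of_nat n * (of_nat (m choose k) *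
        ((-1) ^ k * fact k * of_nat ((n - 1) choose k) * a ^ (m - k) * b ^ (n - 1 - k))))"
      by simp
  qed simp
  ultimately show ?thesis
    using sum_choose_Suc[of m f] by (simp add: hermite_poly_def[of "Suc m"] f_def)
qed

text \<open>Only the coefficient of \<open>cnj h\<close> is made explicit: on these polynomials just
  \<open>wirtinger_cnj\<close> is applied. The induction needs arbitrary \<open>n\<close> because
  the recurrence also involves \<open>n - 1\<close>.\<close>

lemma hermite_poly_has_derivative:
  "\<exists>A. ((\<lambda>\<xi>. hermite_poly m n \<xi> (cnj \<xi>)) has_derivative
        (\<lambda>h. A * h + of_nat n * hermite_poly m (n - 1) \<zeta> (cnj \<zeta>) * cnj h)) (at \<zeta>)"
proof (induction m arbitrary: n)
  case 0
  have "((\<lambda>\<xi>. cnj \<xi> ^ n) has_derivative (\<lambda>h. 0 * h + of_nat n * cnj \<zeta> ^ (n - 1) * cnj h)) (at \<zeta>)"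
    by (rule has_derivative_eq_rhs, rule has_derivative_power, rule has_derivative_cnj) (auto simp: fun_eq_iff)
  then show ?case by (intro exI[of _ 0]) simp
next
  case (Suc m)
  obtain A1 A2 where A1: "((\<lambda>\<xi>. hermite_poly m n \<xi> (cnj \<xi>)) has_derivative
        (\<lambda>h. A1 * h + of_nat n * hermite_poly m (n - 1) \<zeta> (cnj \<zeta>) * cnj h)) (at \<zeta>)"
    and A2: "((\<lambda>\<xi>. hermite_poly m (n - 1) \<xi> (cnj \<xi>)) has_derivative
        (\<lambda>h. A2 * h + of_nat (n - 1) * hermite_poly m (n - 1 - 1) \<zeta> (cnj \<zeta>) * cnj h)) (at \<zeta>)"
    using Suc.IH by meson
  \<comment> \<open>The recurrence, read backwards at \<open>n - 1\<close>, collects the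
    coefficients of \<open>cnj h\<close>.\<close>
  have "((\<lambda>\<xi>. hermite_poly (Suc m) n \<xi> (cnj \<xi>)) has_derivative
      (\<lambda>h. (\<zeta> * A1 + hermite_poly m n \<zeta> (cnj \<zeta>) - of_nat n * A2) * h
          + of_nat n * hermite_poly (Suc m) (n - 1) \<zeta> (cnj \<zeta>) * cnj h)) (at \<zeta>)"
    unfolding hermite_poly_Suc
    by (rule has_derivative_eq_rhs, rule has_derivative_diff, rule has_derivative_mult[OF has_derivative_ident A1],
        rule has_derivative_mult[OF has_derivative_const A2]) (simp add: fun_eq_iff algebra_simps)
  then show ?case by blast
qed

section \<open>Iterated derivatives of the Gaussian\<close>

lemma wirtinger_power_gaussian:
  "(wirtinger ^^ n) gaussian = (\<lambda>\<zeta>. (-1) ^ n * cnj \<zeta> ^ n * gaussian \<zeta>)"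
proof (induction n)
  case (Suc n)
  have "((\<lambda>\<xi>. (-1) ^ n * cnj \<xi> ^ n) has_derivative
      (\<lambda>h. 0 * h + ((-1) ^ n * of_nat n * cnj \<zeta> ^ (n - 1)) * cnj h)) (at \<zeta>)" for \<zeta>
    by (rule has_derivative_eq_rhs, rule has_derivative_mult[OF has_derivative_const],
        rule has_derivative_power, rule has_derivative_cnj) (auto simp: fun_eq_iff)
  from wirtinger_mult_gaussian(1)[OF this] show ?case
    by (simp add: Suc.IH fun_eq_iff)
qed simp

text \<open>Each application acts on the polynomial factor as the negative of the recurrence
  \<open>hermite_poly_Suc\<close>, hence one more sign per step.\<close>

lemma wirtinger_cnj_power_gaussian:
  "(wirtinger_cnj ^^ m) ((wirtinger ^^ n) gaussian) =
     (\<lambda>\<zeta>. (-1) ^ (m + n) * hermite_poly m n \<zeta> (cnj \<zeta>) * gaussian \<zeta>)"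
proof (induction m)
  case (Suc m)
  show ?case
  proof
    fix \<zeta>
    obtain A where "((\<lambda>\<xi>. hermite_poly m n \<xi> (cnj \<xi>)) has_derivative
        (\<lambda>h. A * h + of_nat n * hermite_poly m (n - 1) \<zeta> (cnj \<zeta>) * cnj h)) (at \<zeta>)"
      using hermite_poly_has_derivative by blast
    from has_derivative_mult[OF has_derivative_const[of "(-1) ^ (m + n)"] this]
    have "((\<lambda>\<xi>. (-1) ^ (m + n) * hermite_poly m n \<xi> (cnj \<xi>)) has_derivative
        (\<lambda>h. ((-1) ^ (m + n) * A) * h
           + ((-1) ^ (m + n) * (of_nat n * hermite_poly m (n - 1) \<zeta> (cnj \<zeta>))) * cnj h)) (at \<zeta>)"
      by (rule has_derivative_eq_rhs) (simp add: fun_eq_iff algebra_simps)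
    from wirtinger_mult_gaussian(2)[OF this]
    show "(wirtinger_cnj ^^ Suc m) ((wirtinger ^^ n) gaussian) \<zeta> =
        (-1) ^ (Suc m + n) * hermite_poly (Suc m) n \<zeta> (cnj \<zeta>) * gaussian \<zeta>"
      by (simp add: Suc.IH hermite_poly_Suc algebra_simps)
  qed
qed (simp add: wirtinger_power_gaussian)

lemma complex_hermite_eq: "complex_hermite m n \<zeta> = hermite_poly m n \<zeta> (cnj \<zeta>)"
proof -
  have norm: "complex_of_real ((cmod \<xi>)\<^sup>2) = \<xi> * cnj \<xi>" for \<xi>
    by (rule complex_norm_square)
  have gaussian: "(\<lambda>\<xi>. of_real (exp (- (cmod \<xi>)\<^sup>2))) = gaussian"
    by (rule ext) (simp only: gaussian_def exp_of_real[symmetric] of_real_minus norm)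
  have cancel: "of_real (exp ((cmod \<zeta>)\<^sup>2)) * gaussian \<zeta> = 1"
    by (simp only: gaussian_def exp_of_real[symmetric] norm exp_minus) simp
  have signs: "(-1) ^ (m + n) * e * ((-1) ^ (m + n) * p * g) = p * (e * g)" for e p g :: complex
  proof -
    have "(-1) ^ (m + n) * e * ((-1) ^ (m + n) * p * g) = ((-1) ^ (m + n) * (-1) ^ (m + n)) * (p * (e * g))"
      by (simp only: ac_simps)
    then show ?thesis by (simp flip: power_mult_distrib)
  qed
  show ?thesis
    by (simp only: complex_hermite_def gaussian wirtinger_cnj_power_gaussian signs cancel mult_1_right)
qed

section \<open>Generating functions\<close>

text \<open>Summing row by row gives the value. Joint summability holds because complex summability
  is absolute and the norms multiply.\<close>

lemma has_sum_mult_Times: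
  fixes f :: "'a \<Rightarrow> complex" and g :: "'b \<Rightarrow> complex"
  assumes f: "(f has_sum s) A" and g: "(g has_sum t) B"
  shows "((\<lambda>(x, y). f x * g y) has_sum s * t) (A \<times> B)"
proof (rule has_sum_SigmaI)
  show "((\<lambda>y. case (x, y) of (x, y) \<Rightarrow> f x * g y) has_sum f x * t) B" for x
    using has_sum_cmult_right[OF g] by simp
  show "((\<lambda>x. f x * t) has_sum s * t) A"
    by (rule has_sum_cmult_left[OF f])
  have f': "(\<lambda>x. norm (f x)) summable_on A" and g': "(\<lambda>x. norm (g x)) summable_on B"
    using f g summable_on_iff_abs_summable_on_complex by (auto simp: summable_on_def)
  have "(\<lambda>p. norm (case p of (x, y) \<Rightarrow> f x * g y)) summable_on A \<times> B"
    unfolding Infinite_Sum.abs_summable_on_Sigma_iff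
    using f' g'
    by (auto simp: norm_mult infsum_cmult_right' abs_mult
        intro!: summable_on_cmult_right summable_on_cmult_left infsum_nonneg)
  then show "(\<lambda>(x, y). f x * g y) summable_on A \<times> B"
    using summable_on_iff_abs_summable_on_complex by blast
qed

lemma exp_has_sum: "((\<lambda>k. z ^ k / fact k) has_sum exp z) UNIV" for z :: complex
proof (rule norm_summable_imp_has_sum)
  show "summable (\<lambda>k. norm (z ^ k / fact k))"
    using summable_norm_exp[of z] by (simp add: norm_mult norm_divide norm_inverse divide_inverse mult.commute)
  show "(\<lambda>k. z ^ k / fact k) sums exp z"
    using exp_converges[of z] by (simp add: scaleR_conv_of_real divide_inverse mult.commute)
qed

lemma binomial_has_sum:
  "((\<lambda>k. of_nat (n choose k) * x ^ k * y ^ (n - k)) has_sum (x + y) ^ n) UNIV" for x y :: complex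
  by (rule has_sum_finite_neutralI[of "{..n}"]) (auto simp: binomial_ring)

section \<open>Generating series of the polynomials\<close>

text \<open>The factorials of \<open>m\<close> and \<open>k\<close> cancel, which separates the
  dependence on \<open>k\<close> from that on \<open>m - k\<close>.\<close>

lemma hermite_poly_term:
  fixes u a b :: complex
  assumes "k \<le> m"
  shows "u ^ m / fact m * (of_nat (m choose k) * ((-1) ^ k * fact k * of_nat (n choose k) * a ^ (m - k) * b ^ (n - k)))
       = of_nat (n choose k) * (- u) ^ k * b ^ (n - k) * ((u * a) ^ (m - k) / fact (m - k))"
proof -
  have "u ^ m = u ^ k * u ^ (m - k)"
    using assms by (simp flip: power_add)
  then show ?thesis
    using assms by (simp add: binomial_fact field_simps power_mult_distrib power_minus[of u])
qed

lemma hermite_poly_generating: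
  "((\<lambda>m. u ^ m / fact m * hermite_poly m n a b) has_sum (b - u) ^ n * exp (u * a)) UNIV"
proof -
  define t where "t = (\<lambda>(k, i). of_nat (n choose k) * (- u) ^ k * b ^ (n - k) * ((u * a) ^ i / fact i))"
  have "(t has_sum (- u + b) ^ n * exp (u * a)) (UNIV \<times> UNIV)"
    unfolding t_def by (rule has_sum_mult_Times[OF binomial_has_sum exp_has_sum])
  \<comment> \<open>Setting m = k + i maps all pairs (k, i) bijectively onto the triangle k \<le> m,
    whose rows are the finite sums in \<open>hermite_poly\<close>.\<close>
  also have "?this \<longleftrightarrow> ((\<lambda>(m, k). t (k, m - k)) has_sum (b - u) ^ n * exp (u * a)) (Sigma UNIV (\<lambda>m. {..m}))"
    by (rule has_sum_reindex_bij_witness[of _ "\<lambda>(m, k). (k, m - k)" "\<lambda>(k, i). (k + i, k)"]) auto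
  finally show ?thesis
  proof (rule has_sum_Sigma')
    fix m
    have "u ^ m / fact m * hermite_poly m n a b = (\<Sum>k\<le>m. t (k, m - k))"
      unfolding hermite_poly_def sum_distrib_left t_def
      by (rule sum.cong) (use hermite_poly_term[of _ m u n a b] in auto)
    then show "((\<lambda>k. case (m, k) of (m, k) \<Rightarrow> t (k, m - k)) has_sum u ^ m / fact m * hermite_poly m n a b) {..m}"
      by simp
  qed
qed

lemma hermite_poly_double_generating:
  "((\<lambda>(m, n). u ^ m / fact m * (v ^ n / fact n) * hermite_poly m n a b)
     has_sum exp (- (u * v) + u * a + v * b)) (UNIV \<times> UNIV)"
proof -
  define t where "t = (\<lambda>(k, i, j). (- (u * v)) ^ k / fact k * ((u * a) ^ i / fact i * ((v * b) ^ j / fact j)))"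
  define s where "s = exp (- (u * v) + u * a + v * b)"
  have "((\<lambda>(k, p). (- (u * v)) ^ k / fact k * (case p of (i, j) \<Rightarrow> (u * a) ^ i / fact i * ((v * b) ^ j / fact j)))
      has_sum exp (- (u * v)) * (exp (u * a) * exp (v * b))) (UNIV \<times> UNIV \<times> UNIV)"
    by (intro has_sum_mult_Times exp_has_sum)
  then have "(t has_sum s) (UNIV \<times> UNIV \<times> UNIV)"
    by (simp only: t_def s_def exp_add mult.assoc case_prod_unfold fst_conv snd_conv)
  \<comment> \<open>Here m = k + i and n = k + j, so exactly the \<open>k\<close> up to
    \<open>min m n\<close> occur.\<close>
  also have "?this \<longleftrightarrow> ((\<lambda>((m, n), k). t (k, m - k, n - k)) has_sum s)
      (Sigma (UNIV \<times> UNIV) (\<lambda>(m, n). {..min m n}))"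
    by (rule has_sum_reindex_bij_witness[of _ "\<lambda>((m, n), k). (k, m - k, n - k)"
          "\<lambda>(k, i, j). ((k + i, k + j), k)"]) auto
  finally show ?thesis
    unfolding s_def[symmetric]
  proof (rule has_sum_Sigma')
    fix p :: "nat \<times> nat"
    obtain m n where p: "p = (m, n)" by (cases p)
    have "u ^ m / fact m * (v ^ n / fact n) * hermite_poly m n a b =
        (\<Sum>k\<le>m. v ^ n / fact n *
          (of_nat (n choose k) * (- u) ^ k * b ^ (n - k) * ((u * a) ^ (m - k) / fact (m - k))))"
      unfolding hermite_poly_def sum_distrib_left
      by (rule sum.cong[OF refl], simp only: atMost_iff hermite_poly_term[symmetric]) (simp only: ac_simps)
    \<comment> \<open>The dropped terms have k > n, where \<open>n choose k\<close> is 0; for the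
      others \<open>n - k\<close> is a true difference.\<close>
    also have "\<dots> = (\<Sum>k\<le>min m n. v ^ n / fact n *
          (of_nat (n choose k) * (- u) ^ k * b ^ (n - k) * ((u * a) ^ (m - k) / fact (m - k))))"
      by (rule sum.mono_neutral_right) auto
    also have "\<dots> = (\<Sum>k\<le>min m n. t (k, m - k, n - k))"
    proof (rule sum.cong)
      fix k assume "k \<in> {..min m n}"
      then have "k \<le> n" by simp
      moreover from this have "v ^ n = v ^ k * v ^ (n - k)"
        by (simp flip: power_add)
      ultimately show "v ^ n / fact n *
          (of_nat (n choose k) * (- u) ^ k * b ^ (n - k) * ((u * a) ^ (m - k) / fact (m - k)))
          = t (k, m - k, n - k)"
        by (simp add: t_def binomial_fact power_mult_distrib field_simps power_minus[of u] power_minus[of "u * v"])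
    qed simp
    finally have "u ^ m / fact m * (v ^ n / fact n) * hermite_poly m n a b = (\<Sum>k\<le>min m n. t (k, m - k, n - k))" .
    then show "((\<lambda>k. (\<lambda>((m, n), k). t (k, m - k, n - k)) (p, k)) has_sum
        (case p of (m, n) \<Rightarrow> u ^ m / fact m * (v ^ n / fact n) * hermite_poly m n a b))
        (case p of (m, n) \<Rightarrow> {..min m n})"
      by (simp add: p)
  qed
qed

text \<open>The double series are stated as unconditional sums over all pairs, which is stronger
  than convergence of the iterated sums.\<close>

theorem proposition3p29:
  fixes z w u v u' :: complex
  shows "(\<forall>n n'::nat.
            ((\<lambda>(m::nat, m'::nat). u ^ m / fact m * (u' ^ m' / fact m') * complex_hermite2 m n m' n' z w)
              has_sum ((cnj z - \<i> * cnj w - u) ^ n * (z - \<i> * w - u') ^ n'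
                       * exp (u * (z + \<i> * w) + u' * (cnj z + \<i> * cnj w)))) (UNIV \<times> UNIV))
       \<and> (\<forall>m' n'::nat.
            ((\<lambda>(m::nat, n::nat). u ^ m / fact m * (v ^ n / fact n) * complex_hermite2 m n m' n' z w)
              has_sum (exp (- (u * v) + u * (z + \<i> * w) + v * (cnj z - \<i> * cnj w))
                       * complex_hermite m' n' (cnj z + \<i> * cnj w))) (UNIV \<times> UNIV))"
proof (intro conjI allI)
  fix n n' :: nat
  \<comment> \<open>Each Hermite factor contains only one of the two summation indices, so the
    series is a product of two single generating series.\<close>
  have "((\<lambda>(m, m'). (u ^ m / fact m * complex_hermite m n (z + \<i> * w)) *
          (u' ^ m' / fact m' * complex_hermite m' n' (cnj z + \<i> * cnj w)))
      has_sum ((cnj z - \<i> * cnj w - u) ^ n * exp (u * (z + \<i> * w))) *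
        ((z - \<i> * w - u') ^ n' * exp (u' * (cnj z + \<i> * cnj w)))) (UNIV \<times> UNIV)"
    unfolding complex_hermite_eq cnj_hermite_arguments(1)[of z w] cnj_hermite_arguments(2)
    by (intro has_sum_mult_Times hermite_poly_generating)
  then show "((\<lambda>(m::nat, m'::nat). u ^ m / fact m * (u' ^ m' / fact m') * complex_hermite2 m n m' n' z w)
      has_sum ((cnj z - \<i> * cnj w - u) ^ n * (z - \<i> * w - u') ^ n'
        * exp (u * (z + \<i> * w) + u' * (cnj z + \<i> * cnj w)))) (UNIV \<times> UNIV)"
    unfolding complex_hermite2_def exp_add by (simp only: ac_simps times_divide_eq_left times_divide_eq_right)
next
  fix m' n' :: nat
  \<comment> \<open>Both indices now sit in the first Hermite factor; the second is a constant
    multiplier.\<close>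
  have "((\<lambda>p. (case p of (m, n) \<Rightarrow> u ^ m / fact m * (v ^ n / fact n) * complex_hermite m n (z + \<i> * w))
          * complex_hermite m' n' (cnj z + \<i> * cnj w))
      has_sum exp (- (u * v) + u * (z + \<i> * w) + v * (cnj z - \<i> * cnj w))
        * complex_hermite m' n' (cnj z + \<i> * cnj w)) (UNIV \<times> UNIV)"
    unfolding complex_hermite_eq[of _ _ "z + \<i> * w"] cnj_hermite_arguments
    by (intro has_sum_cmult_left hermite_poly_double_generating)
  then show "((\<lambda>(m::nat, n::nat). u ^ m / fact m * (v ^ n / fact n) * complex_hermite2 m n m' n' z w)
      has_sum (exp (- (u * v) + u * (z + \<i> * w) + v * (cnj z - \<i> * cnj w))
        * complex_hermite m' n' (cnj z + \<i> * cnj w))) (UNIV \<times> UNIV)"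
    by (simp add: complex_hermite2_def case_prod_unfold mult.assoc)
qed

end
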